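(* Let $k\ge 3$ be an integer and let $\Gamma,\Gamma'$ be finite groups of order at least two. If $\mathrm{LG}^+(k,\Gamma)$ and $\mathrm{LG}^+(k,\Gamma')$ are isomorphic matroids, then $\Gamma$ and $\Gamma'$ are isomorphic groups.
   Context: Let $\Gamma$ be a finite group with $|\Gamma|\ge2$ and $k\ge3$. Let $G$ be the graph on $k$ vertices with no loops and exactly $|\Gamma|$ parallel edges between each pair of distinct vertices, where the edges between a given pair all have the same orientation and are labeled by the $|\Gamma|$ distinct elements of $\Gamma$ (a $\Gamma$-labeling: orientation plus $\phi:E(G)\to\Gamma$). A cycle is balanced if some simple closed walk $W$ around it, with edges $e_1,\dots,e_m$, satisfies $\prod_i\phi(e_i)^{\epsilon_i}=1$ ($\epsilon_i=\pm1$ according as $e_i$ is traversed forward/backward). The lift matroid $\mathrm{LG}(k,\Gamma)$ has ground set $E(G)$ and circuits: balanced cycles; two vertex-disjoint unbalanced cycles; two unbalanced cycles sharing exactly one vertex; theta subgraphs all of whose cycles are unbalanced. $\mathrm{LG}^+(k,\Gamma)$ is the extension of $\mathrm{LG}(k,\Gamma)$ by a new element $e_0$ such that $\mathrm{LG}^+(k,\Gamma)\backslash e_0=\mathrm{LG}(k,\Gamma)$ and $\mathrm{LG}^+(k,\Gamma)/e_0$ equals the cycle matroid of $G$. *)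

theory Defs
  imports "HOL-Algebra.Group" "Graph_Theory.Arc_Walk"
begin

section \<open>Matroids\<close>

record 'a matroid =
  ground :: "'a set"
  indep :: "'a set set"

definition is_matroid :: "'a matroid \<Rightarrow> bool" where
  "is_matroid M \<longleftrightarrow>
     finite (ground M) \<and>
     indep M \<subseteq> Pow (ground M) \<and>
     {} \<in> indep M \<and>
     (\<forall>I J. J \<in> indep M \<and> I \<subseteq> J \<longrightarrow> I \<in> indep M) \<and>
     (\<forall>I J. I \<in> indep M \<and> J \<in> indep M \<and> card I < card J \<longrightarrow>
        (\<exists>x \<in> J - I. insert x I \<in> indep M))"

definition matroid_of_circuits :: "'a set \<Rightarrow> 'a set set \<Rightarrow> 'a matroid" where
  "matroid_of_circuits E \<C> = \<lparr>ground = E, indep = {I. I \<subseteq> E \<and> (\<forall>C \<in> \<C>. \<not> C \<subseteq> I)}\<rparr>"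

definition delete :: "'a matroid \<Rightarrow> 'a \<Rightarrow> 'a matroid" where
  "delete M e = \<lparr>ground = ground M - {e}, indep = {I \<in> indep M. e \<notin> I}\<rparr>"

text \<open>Contracting a loop is the same as deleting it.\<close>

definition contract :: "'a matroid \<Rightarrow> 'a \<Rightarrow> 'a matroid" where
  "contract M e =
     (if {e} \<in> indep M
      then \<lparr>ground = ground M - {e}, indep = {I. e \<notin> I \<and> insert e I \<in> indep M}\<rparr>
      else delete M e)"

definition matroid_isomorphic :: "'a matroid \<Rightarrow> 'b matroid \<Rightarrow> bool" where
  "matroid_isomorphic M N \<longleftrightarrow>
     (\<exists>f. bij_betw f (ground M) (ground N) \<and>
          (\<forall>X \<subseteq> ground M. X \<in> indep M \<longleftrightarrow> f ` X \<in> indep N))"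

section \<open>Group-labelled graphs\<close>

text \<open>
  The digraph \<open>G\<close> is an undirected multigraph together with an orientation of its edges.
  Undirected walks in \<open>G\<close> are the directed walks of \<open>bidirected G\<close>, in which
  \<open>(e, True)\<close> traverses \<open>e\<close> forward and \<open>(e, False)\<close> traverses it backward.
\<close>

definition bidirected :: "('v, 'e) pre_digraph \<Rightarrow> ('v, 'e \<times> bool) pre_digraph" where
  "bidirected G =
     \<lparr>verts = verts G,
      arcs = arcs G \<times> UNIV,
      tail = (\<lambda>(e, forward). if forward then tail G e else head G e),
      head = (\<lambda>(e, forward). if forward then head G e else tail G e)\<rparr>"

text \<open>
  The library's cycles have no repeated vertex. Distinctness of the underlying edges
  excludes traversing one edge to and fro.
\<close>

definition simple_closed_walk :: "('v, 'e) pre_digraph \<Rightarrow> ('e \<times> bool) list \<Rightarrow> bool" where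
  "simple_closed_walk G W \<longleftrightarrow>
     pre_digraph.cycle (bidirected G) W \<and> distinct (map fst W)"

text \<open>Cycles, paths and thetas, being subgraphs without isolated vertices, are given by their edge sets.\<close>

definition edges_of :: "('e \<times> bool) list \<Rightarrow> 'e set" where
  "edges_of W = fst ` set W"

definition verts_of :: "('v, 'e) pre_digraph \<Rightarrow> 'e set \<Rightarrow> 'v set" where
  "verts_of G C = tail G ` C \<union> head G ` C"

definition cycles :: "('v, 'e) pre_digraph \<Rightarrow> 'e set set" where
  "cycles G = {edges_of W | W. simple_closed_walk G W}"

definition path_between :: "('v, 'e) pre_digraph \<Rightarrow> 'v \<Rightarrow> 'v \<Rightarrow> 'e set \<Rightarrow> bool" where
  "path_between G u v P \<longleftrightarrow>
     (\<exists>W. pre_digraph.apath (bidirected G) u W v \<and> P = edges_of W)"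

text \<open>
  A theta consists of three paths joining two distinct vertices \<open>u\<close>, \<open>v\<close> that pairwise
  share nothing but these two ends. Edge-disjointness must be required separately, since
  otherwise two of the paths could be the same single edge.
\<close>

definition thetas :: "('v, 'e) pre_digraph \<Rightarrow> 'e set set" where
  "thetas G = {P \<union> Q \<union> R | P Q R. \<exists>u v. u \<noteq> v \<and>
     path_between G u v P \<and> path_between G u v Q \<and> path_between G u v R \<and>
     P \<inter> Q = {} \<and> P \<inter> R = {} \<and> Q \<inter> R = {} \<and>
     verts_of G P \<inter> verts_of G Q = {u, v} \<and>
     verts_of G P \<inter> verts_of G R = {u, v} \<and>
     verts_of G Q \<inter> verts_of G R = {u, v}}"

definition gain :: "('g, 'm) monoid_scheme \<Rightarrow> ('e \<Rightarrow> 'g) \<Rightarrow> ('e \<times> bool) list \<Rightarrow> 'g" where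
  "gain \<Gamma> \<phi> W =
     foldr (\<lambda>(e, forward) x. (if forward then \<phi> e else inv\<^bsub>\<Gamma>\<^esub> \<phi> e) \<otimes>\<^bsub>\<Gamma>\<^esub> x) W \<one>\<^bsub>\<Gamma>\<^esub>"

definition balanced_cycles ::
  "('g, 'm) monoid_scheme \<Rightarrow> ('v, 'e) pre_digraph \<Rightarrow> ('e \<Rightarrow> 'g) \<Rightarrow> 'e set set" where
  "balanced_cycles \<Gamma> G \<phi> =
     {edges_of W | W. simple_closed_walk G W \<and> gain \<Gamma> \<phi> W = \<one>\<^bsub>\<Gamma>\<^esub>}"

definition unbalanced_cycles ::
  "('g, 'm) monoid_scheme \<Rightarrow> ('v, 'e) pre_digraph \<Rightarrow> ('e \<Rightarrow> 'g) \<Rightarrow> 'e set set" where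
  "unbalanced_cycles \<Gamma> G \<phi> = cycles G - balanced_cycles \<Gamma> G \<phi>"

text \<open>
  \<open>G\<close> with labels \<open>\<phi>\<close> is a graph as used to define \<open>LG(k,\<Gamma>)\<close>. The orientation chosen
  for each pair of vertices is arbitrary.
\<close>

definition complete_labelled_graph ::
  "nat \<Rightarrow> ('g, 'm) monoid_scheme \<Rightarrow> ('v, 'e) pre_digraph \<Rightarrow> ('e \<Rightarrow> 'g) \<Rightarrow> bool" where
  "complete_labelled_graph k \<Gamma> G \<phi> \<longleftrightarrow>
     loopfree_digraph G \<and> finite (verts G) \<and> card (verts G) = k \<and>
     (\<forall>u \<in> verts G. \<forall>v \<in> verts G. u \<noteq> v \<longrightarrow>
        (\<exists>(s, t) \<in> {(u, v), (v, u)}.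
           (\<forall>e \<in> arcs G. {tail G e, head G e} = {u, v} \<longrightarrow> tail G e = s \<and> head G e = t) \<and>
           bij_betw \<phi> {e \<in> arcs G. {tail G e, head G e} = {u, v}} (carrier \<Gamma>)))"

section \<open>The lift matroid and its extension\<close>

definition cycle_matroid :: "('v, 'e) pre_digraph \<Rightarrow> 'e matroid" where
  "cycle_matroid G = matroid_of_circuits (arcs G) (cycles G)"

definition lift_circuits ::
  "('g, 'm) monoid_scheme \<Rightarrow> ('v, 'e) pre_digraph \<Rightarrow> ('e \<Rightarrow> 'g) \<Rightarrow> 'e set set" where
  "lift_circuits \<Gamma> G \<phi> =
     balanced_cycles \<Gamma> G \<phi> \<union>
     {C \<union> D | C D. C \<in> unbalanced_cycles \<Gamma> G \<phi> \<and> D \<in> unbalanced_cycles \<Gamma> G \<phi> \<and>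
        verts_of G C \<inter> verts_of G D = {}} \<union>
     {C \<union> D | C D. C \<in> unbalanced_cycles \<Gamma> G \<phi> \<and> D \<in> unbalanced_cycles \<Gamma> G \<phi> \<and>
        card (verts_of G C \<inter> verts_of G D) = 1} \<union>
     {T \<in> thetas G. \<forall>C \<in> cycles G. C \<subseteq> T \<longrightarrow> C \<in> unbalanced_cycles \<Gamma> G \<phi>}"

definition lift_matroid ::
  "('g, 'm) monoid_scheme \<Rightarrow> ('v, 'e) pre_digraph \<Rightarrow> ('e \<Rightarrow> 'g) \<Rightarrow> 'e matroid" where
  "lift_matroid \<Gamma> G \<phi> = matroid_of_circuits (arcs G) (lift_circuits \<Gamma> G \<phi>)"

text \<open>
  \<open>M\<close> is \<open>LG\<^sup>+(k,\<Gamma>)\<close>, built on the labelled graph \<open>(G, \<phi>)\<close> with new element \<open>e0\<close>.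
  The conditions determine \<open>M\<close>: as the lift matroid and the cycle matroid differ, \<open>e0\<close> is
  not a loop, so the two minors give the independent sets avoiding and containing \<open>e0\<close>.
\<close>

definition is_LG_plus ::
  "nat \<Rightarrow> ('g, 'm) monoid_scheme \<Rightarrow> ('v, 'e) pre_digraph \<Rightarrow> ('e \<Rightarrow> 'g) \<Rightarrow> 'e \<Rightarrow> 'e matroid \<Rightarrow> bool"
where
  "is_LG_plus k \<Gamma> G \<phi> e0 M \<longleftrightarrow>
     complete_labelled_graph k \<Gamma> G \<phi> \<and> e0 \<notin> arcs G \<and>
     is_matroid M \<and> ground M = insert e0 (arcs G) \<and>
     delete M e0 = lift_matroid \<Gamma> G \<phi> \<and>
     contract M e0 = cycle_matroid G"

end

theory Submission
  imports Defs
begin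

text \<open>
  Counting elements shows that the two groups have the same order, and order two is trivial.
  From order three on, the lines of \<open>M\<close> with at least four points are exactly the sets
  \<open>e\<^sub>0\<close> plus a class of parallel edges, so an isomorphism fixes the common point \<open>e\<^sub>0\<close> of
  these lines and maps parallel classes to parallel classes. It also maps balanced triangles to
  balanced triangles, these being the dependent triples of pairwise nonparallel edges. On the
  three classes of a single triangle it therefore induces bijections \<open>\<alpha>\<close>, \<open>\<beta>\<close>, \<open>\<gamma>\<close> of the
  groups such that \<open>x y z = 1\<close> implies \<open>\<alpha>(x) \<beta>(y) \<gamma>(z) = 1\<close>, and isotopic groups are isomorphic.
\<close>

section \<open>Isotopic groups\<close>

text \<open>By \<open>prod\<close>, the product of \<alpha>(x) and \<beta>(y) depends only on xy.
  Comparing the factorisations x1 and 1x of x expresses \<alpha> through \<beta>; comparing xy with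
  1(xy) and cancelling \<alpha>(1) then shows that \<beta> is multiplicative up to the constant
  \<beta>(1).\<close>

lemma isotopic_groups_iso:
  assumes "group \<Gamma>" and "group \<Gamma>'"
    and \<alpha>: "bij_betw \<alpha> (carrier \<Gamma>) (carrier \<Gamma>')"
    and \<beta>: "bij_betw \<beta> (carrier \<Gamma>) (carrier \<Gamma>')"
    and \<gamma>: "bij_betw \<gamma> (carrier \<Gamma>) (carrier \<Gamma>')"
    and eq: "\<And>x y z. \<lbrakk>x \<in> carrier \<Gamma>; y \<in> carrier \<Gamma>; z \<in> carrier \<Gamma>; x \<otimes>\<^bsub>\<Gamma>\<^esub> y \<otimes>\<^bsub>\<Gamma>\<^esub> z = \<one>\<^bsub>\<Gamma>\<^esub>\<rbrakk>
      \<Longrightarrow> \<alpha> x \<otimes>\<^bsub>\<Gamma>'\<^esub> \<beta> y \<otimes>\<^bsub>\<Gamma>'\<^esub> \<gamma> z = \<one>\<^bsub>\<Gamma>'\<^esub>"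
  shows "\<Gamma> \<cong> \<Gamma>'"
proof -
  interpret A: group \<Gamma> by fact
  interpret B: group \<Gamma>' by fact
  have in_\<alpha>: "\<alpha> x \<in> carrier \<Gamma>'" and in_\<beta>: "\<beta> x \<in> carrier \<Gamma>'" and in_\<gamma>: "\<gamma> x \<in> carrier \<Gamma>'"
    if "x \<in> carrier \<Gamma>" for x
    using that \<alpha> \<beta> \<gamma> by (auto dest: bij_betwE)
  have prod: "\<alpha> x \<otimes>\<^bsub>\<Gamma>'\<^esub> \<beta> y = inv\<^bsub>\<Gamma>'\<^esub> \<gamma> (inv\<^bsub>\<Gamma>\<^esub> (x \<otimes>\<^bsub>\<Gamma>\<^esub> y))"
    if "x \<in> carrier \<Gamma>" "y \<in> carrier \<Gamma>" for x y
    using eq[of x y "inv\<^bsub>\<Gamma>\<^esub> (x \<otimes>\<^bsub>\<Gamma>\<^esub> y)"] that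
    by (intro B.inv_equality[symmetric]) (auto simp: in_\<alpha> in_\<beta> in_\<gamma>)
  \<comment> \<open>Normalising \<open>\<beta>\<close> to map one to one turns it into a homomorphism.\<close>
  define h where "h = (\<lambda>y. inv\<^bsub>\<Gamma>'\<^esub> \<beta> \<one>\<^bsub>\<Gamma>\<^esub> \<otimes>\<^bsub>\<Gamma>'\<^esub> \<beta> y)"
  have "h \<in> hom \<Gamma> \<Gamma>'"
  proof (rule homI)
    fix x y assume x: "x \<in> carrier \<Gamma>" and y: "y \<in> carrier \<Gamma>"
    have "\<alpha> x \<otimes>\<^bsub>\<Gamma>'\<^esub> \<beta> \<one>\<^bsub>\<Gamma>\<^esub> = \<alpha> \<one>\<^bsub>\<Gamma>\<^esub> \<otimes>\<^bsub>\<Gamma>'\<^esub> \<beta> x"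
      using prod[of x "\<one>\<^bsub>\<Gamma>\<^esub>"] prod[of "\<one>\<^bsub>\<Gamma>\<^esub>" x] x by simp
    then have \<alpha>x: "\<alpha> x = \<alpha> \<one>\<^bsub>\<Gamma>\<^esub> \<otimes>\<^bsub>\<Gamma>'\<^esub> \<beta> x \<otimes>\<^bsub>\<Gamma>'\<^esub> inv\<^bsub>\<Gamma>'\<^esub> \<beta> \<one>\<^bsub>\<Gamma>\<^esub>"
      using x by (simp add: B.inv_solve_right in_\<alpha> in_\<beta>)
    have "\<alpha> \<one>\<^bsub>\<Gamma>\<^esub> \<otimes>\<^bsub>\<Gamma>'\<^esub> \<beta> (x \<otimes>\<^bsub>\<Gamma>\<^esub> y) = \<alpha> x \<otimes>\<^bsub>\<Gamma>'\<^esub> \<beta> y"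
      using prod[of "\<one>\<^bsub>\<Gamma>\<^esub>" "x \<otimes>\<^bsub>\<Gamma>\<^esub> y"] prod[of x y] x y by simp
    also have "\<dots> = \<alpha> \<one>\<^bsub>\<Gamma>\<^esub> \<otimes>\<^bsub>\<Gamma>'\<^esub> (\<beta> x \<otimes>\<^bsub>\<Gamma>'\<^esub> (inv\<^bsub>\<Gamma>'\<^esub> \<beta> \<one>\<^bsub>\<Gamma>\<^esub> \<otimes>\<^bsub>\<Gamma>'\<^esub> \<beta> y))"
      using x y by (simp add: \<alpha>x B.m_assoc in_\<alpha> in_\<beta>)
    finally have "\<beta> (x \<otimes>\<^bsub>\<Gamma>\<^esub> y) = \<beta> x \<otimes>\<^bsub>\<Gamma>'\<^esub> (inv\<^bsub>\<Gamma>'\<^esub> \<beta> \<one>\<^bsub>\<Gamma>\<^esub> \<otimes>\<^bsub>\<Gamma>'\<^esub> \<beta> y)"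
      using x y by (simp add: in_\<alpha> in_\<beta>)
    then show "h (x \<otimes>\<^bsub>\<Gamma>\<^esub> y) = h x \<otimes>\<^bsub>\<Gamma>'\<^esub> h y"
      using x y by (simp add: h_def B.m_assoc in_\<beta>)
  qed (simp add: h_def in_\<beta>)
  moreover have "bij_betw h (carrier \<Gamma>) (carrier \<Gamma>')"
  proof -
    have "bij_betw (\<lambda>y. inv\<^bsub>\<Gamma>'\<^esub> \<beta> \<one>\<^bsub>\<Gamma>\<^esub> \<otimes>\<^bsub>\<Gamma>'\<^esub> y) (carrier \<Gamma>') (carrier \<Gamma>')"
      by (rule bij_betw_byWitness[where f' = "\<lambda>y. \<beta> \<one>\<^bsub>\<Gamma>\<^esub> \<otimes>\<^bsub>\<Gamma>'\<^esub> y"])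
        (auto simp: in_\<beta> B.m_assoc[symmetric])
    from bij_betw_trans[OF \<beta> this] show ?thesis by (simp add: h_def comp_def)
  qed
  ultimately show ?thesis by (auto simp: is_iso_def iso_def)
qed

text \<open>Order two is treated apart because \<open>e0\<close> together with a parallel class then
  has only three points and is not singled out by its size, as it is in
  \<open>class_long_line\<close>.\<close>

lemma groups_of_order_2_iso:
  assumes "group \<Gamma>" and "group \<Gamma>'"
    and "card (carrier \<Gamma>) = 2" and "card (carrier \<Gamma>') = 2"
  shows "\<Gamma> \<cong> \<Gamma>'"
proof -
  have ex: "\<exists>x. x \<noteq> \<one>\<^bsub>H\<^esub> \<and> carrier H = {\<one>\<^bsub>H\<^esub>, x} \<and> x \<otimes>\<^bsub>H\<^esub> x = \<one>\<^bsub>H\<^esub>"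
    if "group H" "card (carrier H) = 2" for H :: "('x, 'y) monoid_scheme"
  proof -
    interpret group H by fact
    obtain p q where pq: "carrier H = {p, q}" "p \<noteq> q"
      using \<open>card (carrier H) = 2\<close> by (auto simp: card_2_iff)
    obtain x where x: "carrier H = {\<one>\<^bsub>H\<^esub>, x}" "x \<noteq> \<one>\<^bsub>H\<^esub>"
    proof (cases "p = \<one>\<^bsub>H\<^esub>")
      case False
      then have "q = \<one>\<^bsub>H\<^esub>" using one_closed pq by auto
      then show ?thesis using pq that[of p] by auto
    qed (use pq that[of q] in auto)
    then have "x \<otimes>\<^bsub>H\<^esub> x \<noteq> x" by (metis insertI1 insertI2 l_cancel_one)
    then show ?thesis using x m_closed[of x x] by auto
  qed
  interpret A: group \<Gamma> by fact
  interpret B: group \<Gamma>' by fact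
  obtain x where x: "x \<noteq> \<one>\<^bsub>\<Gamma>\<^esub>" "carrier \<Gamma> = {\<one>\<^bsub>\<Gamma>\<^esub>, x}" "x \<otimes>\<^bsub>\<Gamma>\<^esub> x = \<one>\<^bsub>\<Gamma>\<^esub>"
    using ex[of \<Gamma>] assms by blast
  obtain y where y: "y \<noteq> \<one>\<^bsub>\<Gamma>'\<^esub>" "carrier \<Gamma>' = {\<one>\<^bsub>\<Gamma>'\<^esub>, y}" "y \<otimes>\<^bsub>\<Gamma>'\<^esub> y = \<one>\<^bsub>\<Gamma>'\<^esub>"
    using ex[of \<Gamma>'] assms by blast
  define h where "h = (\<lambda>z. if z = x then y else \<one>\<^bsub>\<Gamma>'\<^esub>)"
  have xc: "x \<in> carrier \<Gamma>" "y \<in> carrier \<Gamma>'" using x y by auto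
  have "h \<in> hom \<Gamma> \<Gamma>'"
    using xc by (intro homI) (auto simp: h_def x y)
  moreover have "bij_betw h (carrier \<Gamma>) (carrier \<Gamma>')"
    using x(1) y(1) by (auto simp: bij_betw_def inj_on_def h_def x(2) y(2))
  ultimately show ?thesis by (auto simp: is_iso_def iso_def)
qed

section \<open>Short cycles\<close>

text \<open>An unordered pair, so that two edges are parallel exactly when their values agree,
  whichever way they are oriented.\<close>

definition ends :: "('v, 'e) pre_digraph \<Rightarrow> 'e \<Rightarrow> 'v set" where
  "ends G e = {tail G e, head G e}"

definition parallel_class :: "('v, 'e) pre_digraph \<Rightarrow> 'v \<Rightarrow> 'v \<Rightarrow> 'e set" where
  "parallel_class G x y = {e \<in> arcs G. ends G e = {x, y}}"

text \<open>
  The label read when \<open>e\<close> is traversed starting from its end \<open>x\<close>; meaningless if \<open>x\<close> is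
  not an end of \<open>e\<close>.
\<close>

definition label_from ::
  "('g, 'm) monoid_scheme \<Rightarrow> ('v, 'e) pre_digraph \<Rightarrow> ('e \<Rightarrow> 'g) \<Rightarrow> 'v \<Rightarrow> 'e \<Rightarrow> 'g" where
  "label_from \<Gamma> G \<phi> x e = (if tail G e = x then \<phi> e else inv\<^bsub>\<Gamma>\<^esub> \<phi> e)"

text \<open>The vertices are listed in the cyclic order of a closed walk, and each edge is matched
  with the vertex from which the walk enters it. The labels read along the walk are therefore those
  that \<open>label_from\<close> gives at x, y and z.\<close>

definition triangle :: "('v, 'e) pre_digraph \<Rightarrow> 'v \<Rightarrow> 'v \<Rightarrow> 'v \<Rightarrow> 'e \<Rightarrow> 'e \<Rightarrow> 'e \<Rightarrow> bool" where
  "triangle G x y z a b c \<longleftrightarrow> distinct [x, y, z] \<and>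
     a \<in> parallel_class G x y \<and> b \<in> parallel_class G y z \<and> c \<in> parallel_class G z x"

section \<open>Walks around digons and triangles\<close>

lemmas cycle_unfolds = simple_closed_walk_def pre_digraph.cycle_def pre_digraph.awalk_def
  pre_digraph.awalk_verts.simps pre_digraph.cas.simps

lemma bidirected_simps [simp]:
  "verts (bidirected G) = verts G"
  "arcs (bidirected G) = arcs G \<times> UNIV"
  by (simp_all add: bidirected_def)

lemma bidirected_ends:
  "ends G e = {tail (bidirected G) (e, s), head (bidirected G) (e, s)}"
  by (auto simp: bidirected_def ends_def)

text \<open>The flag \<open>tail G e = x\<close> selects the direction that leaves x, so walks can
  be written down without knowing how the edges are oriented.\<close>

lemma tail_bidirected: "ends G e = {x, y} \<Longrightarrow> tail (bidirected G) (e, tail G e = x) = x"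
  by (auto simp: bidirected_def ends_def doubleton_eq_iff)

lemma head_bidirected: "ends G e = {x, y} \<Longrightarrow> head (bidirected G) (e, tail G e = x) = y"
  by (auto simp: bidirected_def ends_def doubleton_eq_iff)

text \<open>Without loops the starting vertex of a traversal reveals its direction. Hence every flag
  in a walk has the form used in \<open>triangle_closed_walk\<close>.\<close>

lemma bidirected_no_loops:
  assumes "loopfree_digraph G" "e \<in> arcs G"
  shows "tail (bidirected G) (e, s) \<noteq> head (bidirected G) (e, s)"
    and "(tail G e = tail (bidirected G) (e, s)) = s"
  using assms
  by (auto simp: loopfree_digraph_def loopfree_digraph_axioms_def bidirected_def)

lemma parallel_class_sym: "parallel_class G x y = parallel_class G y x"
  by (simp add: parallel_class_def insert_commute)

lemma triangle_rotate: "triangle G x y z a b c \<Longrightarrow> triangle G y z x b c a"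
  by (auto simp: triangle_def)

lemma triangle_reverse: "triangle G x y z a b c \<Longrightarrow> triangle G x z y c b a"
  by (auto simp: triangle_def parallel_class_sym)

lemma triangle_ends_distinct:
  assumes "triangle G x y z a b c"
  shows "ends G a \<noteq> ends G b" "ends G a \<noteq> ends G c" "ends G b \<noteq> ends G c"
  using assms by (auto simp: triangle_def parallel_class_def doubleton_eq_iff)

lemma triangle_closed_walk:
  assumes "wf_digraph G" "triangle G x y z a b c"
  shows "simple_closed_walk G [(a, tail G a = x), (b, tail G b = y), (c, tail G c = z)]"
proof -
  have "a \<noteq> b" "a \<noteq> c" "b \<noteq> c"
    using triangle_ends_distinct[OF assms(2)] by auto
  moreover have "x \<in> verts G"
    using assms unfolding wf_digraph_def triangle_def parallel_class_def ends_def
    by (auto simp: doubleton_eq_iff)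
  ultimately show ?thesis
    using assms(2)
    by (auto simp: cycle_unfolds triangle_def parallel_class_def tail_bidirected head_bidirected
        intro!: exI[of _ x])
qed

lemma closed_walk_3_triangle:
  assumes G: "loopfree_digraph G" and W: "simple_closed_walk G [(a, r), (b, s), (c, t)]"
  obtains x y z where "triangle G x y z a b c"
    "r = (tail G a = x)" "s = (tail G b = y)" "t = (tail G c = z)"
proof -
  let ?t = "tail (bidirected G)" and ?h = "head (bidirected G)"
  have arcs: "a \<in> arcs G" "b \<in> arcs G" "c \<in> arcs G"
    and chain: "?h (a, r) = ?t (b, s)" "?h (b, s) = ?t (c, t)" "?h (c, t) = ?t (a, r)"
    \<comment> \<open>The library asks for distinct vertices after the first one of the closed walk;
      the start \<open>?t (a, r)\<close> is therefore counted at its return, in the last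
      place.\<close>
    and dist: "distinct [?t (b, s), ?t (c, t), ?t (a, r)]"
    using W by (auto simp: cycle_unfolds)
  show ?thesis
  proof (rule that)
    show "triangle G (?t (a, r)) (?t (b, s)) (?t (c, t)) a b c"
      using arcs dist bidirected_ends[of G a r] bidirected_ends[of G b s] bidirected_ends[of G c t]
      unfolding chain triangle_def parallel_class_def by auto
  qed (simp_all add: bidirected_no_loops(2)[OF G] arcs)
qed

lemma digon_closed_walk:
  assumes "wf_digraph G" "a \<in> parallel_class G x y" "b \<in> parallel_class G x y" "a \<noteq> b" "x \<noteq> y"
  shows "simple_closed_walk G [(a, tail G a = x), (b, tail G b = y)]"
proof -
  have "x \<in> verts G"
    using assms(1,2) unfolding wf_digraph_def parallel_class_def ends_def
    by (auto simp: doubleton_eq_iff)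
  moreover have "ends G b = {y, x}" "ends G a = {x, y}" "a \<in> arcs G" "b \<in> arcs G"
    using assms by (auto simp: parallel_class_def)
  ultimately show ?thesis
    using assms(4,5)
    by (auto simp: cycle_unfolds tail_bidirected head_bidirected intro!: exI[of _ x])
qed

lemma closed_walk_2_parallel:
  assumes "simple_closed_walk G [(a, r), (b, s)]"
  shows "a \<in> arcs G" "b \<in> arcs G" "a \<noteq> b" "ends G a = ends G b"
proof -
  let ?t = "tail (bidirected G)" and ?h = "head (bidirected G)"
  have "?h (a, r) = ?t (b, s)" "?h (b, s) = ?t (a, r)"
    using assms by (auto simp: cycle_unfolds)
  then show "ends G a = ends G b"
    unfolding bidirected_ends[of G a r] bidirected_ends[of G b s] by auto
qed (use assms in \<open>auto simp: cycle_unfolds\<close>)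

text \<open>Distinctness of the underlying edges makes the length of a walk readable off its edge
  set.\<close>

lemma card_edges_of:
  "simple_closed_walk G W \<Longrightarrow> card (edges_of W) = length W"
  unfolding simple_closed_walk_def edges_of_def
  by (metis distinct_card length_map set_map)

lemma edges_of_subset: "simple_closed_walk G W \<Longrightarrow> edges_of W \<subseteq> arcs G"
  by (auto simp: cycle_unfolds edges_of_def)

lemma closed_walk_length:
  assumes "loopfree_digraph G" "simple_closed_walk G W"
  shows "length W \<ge> 2"
proof (rule ccontr)
  assume "\<not> length W \<ge> 2"
  moreover have "W \<noteq> []" using assms(2) by (auto simp: cycle_unfolds)
  ultimately obtain e s where "W = [(e, s)]"
    by (cases W; cases "tl W") auto
  with assms bidirected_no_loops(1)[OF assms(1), of e s] show False
    by (auto simp: cycle_unfolds)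
qed

section \<open>Cycles and thetas with at most three edges\<close>

lemma cycle_walk:
  assumes "loopfree_digraph G" "C \<in> cycles G"
  obtains W where "simple_closed_walk G W" "C = edges_of W" "card C = length W" "length W \<ge> 2"
  using assms by (auto simp: cycles_def card_edges_of closed_walk_length)

lemma card_2_cycle_parallel:
  assumes "loopfree_digraph G" "C \<in> cycles G" "card C = 2" "a \<in> C" "b \<in> C"
  shows "ends G a = ends G b"
proof -
  obtain W where W: "simple_closed_walk G W" "C = edges_of W" "card C = length W"
    using assms cycle_walk by blast
  then obtain c r d s where "W = [(c, r), (d, s)]"
    using assms(3) by (cases W; cases "tl W") auto
  with W closed_walk_2_parallel[of G c r d s] assms(4,5) show ?thesis
    by (auto simp: edges_of_def)
qed

lemma card_3_cycle_triangle:
  assumes "loopfree_digraph G" "simple_closed_walk G W" "length W = 3"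
  obtains x y z a b c where "triangle G x y z a b c"
    "W = [(a, tail G a = x), (b, tail G b = y), (c, tail G c = z)]" "edges_of W = {a, b, c}"
proof -
  obtain a r b s c t where W: "W = [(a, r), (b, s), (c, t)]"
    using assms(3) by (cases W; cases "tl W"; cases "tl (tl W)") auto
  obtain x y z where "triangle G x y z a b c"
    "r = (tail G a = x)" "s = (tail G b = y)" "t = (tail G c = z)"
    using closed_walk_3_triangle assms(1,2) unfolding W by metis
  then show ?thesis using that W by (auto simp: edges_of_def)
qed

text \<open>A loopless graph has no cycle with fewer than two edges, so the cycle fills the pair,
  and a closed walk of length two runs along parallel edges.\<close>

lemma cycle_within_pair:
  assumes "loopfree_digraph G" "C \<in> cycles G" "C \<subseteq> {a, b}"
  shows "C = {a, b}" "a \<noteq> b" "ends G a = ends G b"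
proof -
  have "card C \<ge> 2" using assms cycle_walk by metis
  moreover have "card C \<le> card {a, b}" using assms(3) by (intro card_mono) auto
  moreover have "card {a, b} \<le> 2" by (simp add: card_insert_if)
  ultimately have *: "card C = 2" "card {a, b} = 2" by auto
  then show C: "C = {a, b}" using assms(3) by (intro card_subset_eq) auto
  show "a \<noteq> b" using *(2) by auto
  show "ends G a = ends G b" using card_2_cycle_parallel[OF assms(1,2) *(1)] C by auto
qed

text \<open>A smaller cycle would be a digon, whose edges are parallel.\<close>

lemma cycle_within_nonparallel_triple:
  assumes "loopfree_digraph G" "C \<in> cycles G" "C \<subseteq> {a, b, c}"
    and "ends G a \<noteq> ends G b" "ends G a \<noteq> ends G c" "ends G b \<noteq> ends G c"
  shows "C = {a, b, c}"
proof -
  have d: "a \<noteq> b" "a \<noteq> c" "b \<noteq> c" using assms by auto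
  have "card C \<noteq> 2"
  proof
    assume 2: "card C = 2"
    then obtain p q where "C = {p, q}" "p \<noteq> q" by (auto simp: card_2_iff)
    with card_2_cycle_parallel[OF assms(1,2) 2, of p q] assms(3-6) show False by auto
  qed
  moreover have "card C \<ge> 2" using assms cycle_walk by metis
  ultimately have "card {a, b, c} \<le> card C" using d by simp
  then show ?thesis using assms(3) by (intro card_seteq) auto
qed

text \<open>Each vertex is the only common end of the two edges that meet there.\<close>

lemma triangle_unique:
  assumes "triangle G x y z a b c" "triangle G u v w a b c"
  shows "x = u" "y = v" "z = w"
proof -
  have "{x, y} = {u, v}" "{y, z} = {v, w}" "{z, x} = {w, u}" "u \<noteq> v" "v \<noteq> w" "w \<noteq> u"
    using assms by (auto simp: triangle_def parallel_class_def)
  then show "x = u" "y = v" "z = w" by (metis doubleton_eq_iff)+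
qed

text \<open>Rotations and reversals reach all six orders of three edges, and
  \<open>triangle_unique\<close> fixes the vertices belonging to each order. This compares an
  unknown walk around a triangle with a given one.\<close>

lemma triangle_relabel:
  assumes "triangle G x y z a b c" and t: "triangle G u v w p q r" and "{a, b, c} = {p, q, r}"
  shows "(x, y, z, a, b, c) \<in> {(u, v, w, p, q, r), (v, w, u, q, r, p), (w, u, v, r, p, q),
    (u, w, v, r, q, p), (w, v, u, q, p, r), (v, u, w, p, r, q)}"
proof -
  have ts: "triangle G v w u q r p" "triangle G w u v r p q" "triangle G u w v r q p"
    "triangle G w v u q p r" "triangle G v u w p r q"
    using t by (blast intro: triangle_rotate triangle_reverse)+
  have d: "a \<noteq> b" "a \<noteq> c" "b \<noteq> c" using triangle_ends_distinct[OF assms(1)] by auto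
  have "a \<in> {p, q, r}" "b \<in> {p, q, r}" "c \<in> {p, q, r}" using assms(3) by blast+
  with d consider "a = p" "b = q" "c = r" | "a = q" "b = r" "c = p" | "a = r" "b = p" "c = q"
    | "a = r" "b = q" "c = p" | "a = q" "b = p" "c = r" | "a = p" "b = r" "c = q"
    by (elim insertE emptyE) simp_all
  then show ?thesis
    by cases (use triangle_unique[of G x y z a b c] assms(1) t ts in auto)
qed

text \<open>The three paths are edge-disjoint and nonempty, so within three edges each path is a
  single edge joining u and v.\<close>

lemma theta_three_parallel:
  assumes "T \<in> thetas G" "T \<subseteq> {a, b, c}" "loopfree_digraph G"
  shows "a \<noteq> b" "a \<noteq> c" "b \<noteq> c" "ends G a = ends G b"
proof -
  obtain P Q R u v where T: "T = P \<union> Q \<union> R" and "u \<noteq> v"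
    and disj: "P \<inter> Q = {}" "P \<inter> R = {}" "Q \<inter> R = {}"
    and V: "verts_of G P \<inter> verts_of G Q = {u, v}" "verts_of G P \<inter> verts_of G R = {u, v}"
       "verts_of G Q \<inter> verts_of G R = {u, v}"
    using assms(1) unfolding thetas_def by blast
  \<comment> \<open>The ends u and v lie on every path, which an empty edge set could not
    provide.\<close>
  have ne: "P \<noteq> {}" "Q \<noteq> {}" "R \<noteq> {}" using V by (auto simp: verts_of_def)
  have fin: "finite P" "finite Q" "finite R"
    using assms(2) T by (auto intro: finite_subset)
  have "card T = card P + card Q + card R"
    using disj fin by (simp add: T card_Un_disjoint Int_Un_distrib2)
  moreover have "card P \<ge> 1" "card Q \<ge> 1" "card R \<ge> 1"
    using ne fin by (auto simp: Suc_le_eq card_gt_0_iff)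
  moreover have "card T \<le> card {a, b, c}" using assms(2) by (intro card_mono) auto
  moreover have "card {a, b, c} \<le> 3" by (simp add: card_insert_if)
  ultimately have c: "card P = 1" "card Q = 1" "card R = 1" "card {a, b, c} = 3" "card T = 3" by auto
  then obtain p q r where pqr: "P = {p}" "Q = {q}" "R = {r}" by (auto simp: card_1_singleton_iff)
  have "ends G e = {u, v}" if "u \<in> ends G e" "v \<in> ends G e" for e
    using that \<open>u \<noteq> v\<close> by (auto simp: ends_def)
  then have e: "ends G p = {u, v}" "ends G q = {u, v}" "ends G r = {u, v}"
    using V unfolding pqr verts_of_def by (simp_all add: ends_def) blast+
  show "a \<noteq> b" "a \<noteq> c" "b \<noteq> c" using c(4) by (auto simp: card_insert_if split: if_splits)
  have "T = {a, b, c}" using assms(2) c(4,5) by (intro card_subset_eq) auto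
  then have "a \<in> {p, q, r}" "b \<in> {p, q, r}" unfolding T pqr by auto
  then show "ends G a = ends G b" using e by (metis insertE singletonD)
qed

section \<open>Small sets in the extended lift matroid\<close>

locale LG_plus = group \<Gamma>
  for \<Gamma> :: "('g, 'm) monoid_scheme" (structure) +
  fixes k :: nat and G :: "('v, 'e) pre_digraph" and \<phi> :: "'e \<Rightarrow> 'g"
    and e0 :: 'e and M :: "'e matroid"
  assumes k_ge: "k \<ge> 3" and card_ge: "card (carrier \<Gamma>) \<ge> 2"
    and LG_plus: "is_LG_plus k \<Gamma> G \<phi> e0 M"
begin

abbreviation lab :: "'v \<Rightarrow> 'e \<Rightarrow> 'g" where "lab \<equiv> label_from \<Gamma> G \<phi>"
abbreviation cls :: "'v \<Rightarrow> 'v \<Rightarrow> 'e set" where "cls \<equiv> parallel_class G"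

section \<open>Parallel classes and their labels\<close>

lemma matroid: "is_matroid M" and ground: "ground M = insert e0 (arcs G)"
  and e0: "e0 \<notin> arcs G" and complete: "complete_labelled_graph k \<Gamma> G \<phi>"
  and delete_e0: "delete M e0 = lift_matroid \<Gamma> G \<phi>"
  and contract_e0: "contract M e0 = cycle_matroid G"
  using LG_plus by (simp_all add: is_LG_plus_def)

lemma loopfree: "loopfree_digraph G" and finite_verts: "finite (verts G)"
  and card_verts: "card (verts G) = k"
  using complete by (simp_all add: complete_labelled_graph_def)

lemma wf: "wf_digraph G"
  using loopfree by (simp add: loopfree_digraph_def)

text \<open>The orientation of a pair of vertices is arbitrary but common to all its edges; s is the
  end from which they all start.\<close>

lemma class_bij:
  assumes "x \<in> verts G" "y \<in> verts G" "x \<noteq> y"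
  obtains s where "s \<in> {x, y}" "\<And>e. e \<in> cls x y \<Longrightarrow> tail G e = s"
    "bij_betw \<phi> (cls x y) (carrier \<Gamma>)"
proof -
  from complete have "\<forall>u\<in>verts G. \<forall>v\<in>verts G. u \<noteq> v \<longrightarrow> (\<exists>(s, t)\<in>{(u, v), (v, u)}.
      (\<forall>e\<in>arcs G. ends G e = {u, v} \<longrightarrow> tail G e = s \<and> head G e = t) \<and>
      bij_betw \<phi> (cls u v) (carrier \<Gamma>))"
    unfolding complete_labelled_graph_def parallel_class_def ends_def by (elim conjE)
  then have "\<exists>(s, t)\<in>{(x, y), (y, x)}.
      (\<forall>e\<in>arcs G. ends G e = {x, y} \<longrightarrow> tail G e = s \<and> head G e = t) \<and>
      bij_betw \<phi> (cls x y) (carrier \<Gamma>)"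
    using assms by blast
  then obtain s t where "(s, t) \<in> {(x, y), (y, x)}"
    "\<forall>e\<in>arcs G. ends G e = {x, y} \<longrightarrow> tail G e = s \<and> head G e = t"
    "bij_betw \<phi> (cls x y) (carrier \<Gamma>)"
    by blast
  then show ?thesis by (intro that[of s]) (auto simp: parallel_class_def)
qed

lemma arc_class:
  assumes "e \<in> arcs G"
  obtains x y where "x \<in> verts G" "y \<in> verts G" "x \<noteq> y" "e \<in> cls x y"
proof (rule that)
  show "tail G e \<noteq> head G e"
    using loopfree assms by (auto simp: loopfree_digraph_def loopfree_digraph_axioms_def)
qed (use wf assms in \<open>auto simp: wf_digraph_def parallel_class_def ends_def\<close>)

lemma class_verts:
  assumes "e \<in> cls x y"
  shows "x \<in> verts G" "y \<in> verts G" "x \<noteq> y" "e \<in> arcs G"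
proof -
  show e: "e \<in> arcs G" using assms by (simp add: parallel_class_def)
  obtain u v where "u \<in> verts G" "v \<in> verts G" "u \<noteq> v" "e \<in> cls u v"
    using arc_class[OF e] .
  then show "x \<in> verts G" "y \<in> verts G" "x \<noteq> y"
    using assms by (auto simp: parallel_class_def doubleton_eq_iff)
qed

lemma label_closed: "e \<in> arcs G \<Longrightarrow> \<phi> e \<in> carrier \<Gamma>"
  by (metis arc_class class_bij bij_betwE)

lemma lab_closed: "e \<in> arcs G \<Longrightarrow> lab x e \<in> carrier \<Gamma>"
  by (simp add: label_from_def label_closed)

lemma lab_reverse:
  assumes "e \<in> cls x y"
  shows "lab y e = inv (lab x e)"
proof -
  have "x \<noteq> y" "e \<in> arcs G" using class_verts[OF assms] by auto
  moreover have "tail G e = x \<or> tail G e = y"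
    using assms by (auto simp: parallel_class_def ends_def doubleton_eq_iff)
  ultimately show ?thesis by (auto simp: label_from_def label_closed)
qed

text \<open>Since a class has one orientation, its labels read from x are either all values of
  \<phi> or all their inverses, and inversion permutes the group.\<close>

lemma lab_bij:
  assumes "x \<in> verts G" "y \<in> verts G" "x \<noteq> y"
  shows "bij_betw (lab x) (cls x y) (carrier \<Gamma>)"
proof -
  obtain s where s: "s \<in> {x, y}" "\<And>e. e \<in> cls x y \<Longrightarrow> tail G e = s"
    and bij: "bij_betw \<phi> (cls x y) (carrier \<Gamma>)"
    using class_bij[OF assms] by blast
  show ?thesis
  proof (cases "s = x")
    case True
    then show ?thesis
      using bij s by (subst bij_betw_cong[where g = \<phi>]) (auto simp: label_from_def)
  next
    case False
    have "bij_betw (\<lambda>g. inv g) (carrier \<Gamma>) (carrier \<Gamma>)"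
      by (rule bij_betw_byWitness[where f' = "\<lambda>g. inv g"]) auto
    from bij_betw_trans[OF bij this] show ?thesis
      using s False by (subst bij_betw_cong[where g = "(\<lambda>g. inv g) \<circ> \<phi>"]) (auto simp: label_from_def)
  qed
qed

lemma finite_arcs: "finite (arcs G)"
  using matroid ground by (simp add: is_matroid_def)

lemma card_class: "x \<in> verts G \<Longrightarrow> y \<in> verts G \<Longrightarrow> x \<noteq> y \<Longrightarrow> card (cls x y) = card (carrier \<Gamma>)"
  using bij_betw_same_card[OF lab_bij] .

text \<open>The arcs are sorted by their pair of ends. The count recovers the order of the group
  from the size of the ground set in \<open>card_carrier\<close>.\<close>

lemma card_arcs: "card (arcs G) = (k choose 2) * card (carrier \<Gamma>)"
proof -
  let ?P = "{s. s \<subseteq> verts G \<and> card s = 2}"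
  have fin: "finite ?P" using finite_verts by simp
  have "arcs G = (\<Union>s\<in>?P. {e \<in> arcs G. ends G e = s})"
  proof (intro equalityI subsetI)
    fix e assume e: "e \<in> arcs G"
    from arc_class[OF e] obtain x y
      where "x \<in> verts G" "y \<in> verts G" "x \<noteq> y" "e \<in> cls x y" .
    with e show "e \<in> (\<Union>s\<in>?P. {e \<in> arcs G. ends G e = s})"
      by (auto simp: parallel_class_def)
  qed auto
  then have "card (arcs G) = card (\<Union>s\<in>?P. {e \<in> arcs G. ends G e = s})" by simp
  also have "\<dots> = (\<Sum>s\<in>?P. card {e \<in> arcs G. ends G e = s})"
    using fin finite_arcs by (intro card_UN_disjoint) auto
  also have "\<dots> = (\<Sum>s\<in>?P. card (carrier \<Gamma>))"
  proof (rule sum.cong[OF refl])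
    fix s assume "s \<in> ?P"
    then obtain x y where "s = {x, y}" "x \<noteq> y" "x \<in> verts G" "y \<in> verts G"
      by (auto simp: card_2_iff)
    then show "card {e \<in> arcs G. ends G e = s} = card (carrier \<Gamma>)"
      using card_class[of x y] by (simp add: parallel_class_def)
  qed
  also have "\<dots> = (k choose 2) * card (carrier \<Gamma>)"
    using n_subsets[OF finite_verts, of 2] by (simp add: card_verts)
  finally show ?thesis .
qed

lemma three_vertices:
  obtains u v w where "u \<in> verts G" "v \<in> verts G" "w \<in> verts G" "distinct [u, v, w]"
proof -
  obtain S where S: "S \<subseteq> verts G" "card S = 3"
    using k_ge card_verts by (metis obtain_subset_with_card_n)
  then obtain u v w where "S = {u, v, w}" "u \<noteq> v" "v \<noteq> w" "u \<noteq> w"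
    by (auto simp: card_3_iff)
  with S that[of u v w] show ?thesis by auto
qed

section \<open>Pairs of edges, with and without \<open>e0\<close>\<close>

lemma cycles_balanced_or_unbalanced:
  "unbalanced_cycles \<Gamma> G \<phi> \<subseteq> cycles G" "balanced_cycles \<Gamma> G \<phi> \<subseteq> cycles G"
  by (auto simp: unbalanced_cycles_def balanced_cycles_def cycles_def)

text \<open>Gain one along a digon means that both edges have the same label read from the same end,
  but labels are injective on a parallel class.\<close>

lemma digon_not_balanced:
  assumes "a \<noteq> b" "ends G a = ends G b"
  shows "{a, b} \<notin> balanced_cycles \<Gamma> G \<phi>"
proof
  assume "{a, b} \<in> balanced_cycles \<Gamma> G \<phi>"
  then obtain W where W: "simple_closed_walk G W" "{a, b} = edges_of W" "gain \<Gamma> \<phi> W = \<one>"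
    by (auto simp: balanced_cycles_def)
  have "length W = 2" using card_edges_of[OF W(1)] W(2) assms(1) by (metis card_2_iff)
  then obtain p s q t where W_eq: "W = [(p, s), (q, t)]"
    by (cases W; cases "tl W") auto
  note par = closed_walk_2_parallel[OF W(1)[unfolded W_eq]]
  let ?x = "tail (bidirected G) (p, s)" and ?y = "tail (bidirected G) (q, t)"
  have "head (bidirected G) (p, s) = ?y" "head (bidirected G) (q, t) = ?x"
    using W(1) unfolding W_eq by (auto simp: cycle_unfolds)
  then have pq: "p \<in> cls ?x ?y" "q \<in> cls ?x ?y"
    using par bidirected_ends[of G p s] bidirected_ends[of G q t]
    by (simp_all add: parallel_class_def insert_commute)
  have "lab ?x p = (if s then \<phi> p else inv \<phi> p)" "lab ?y q = (if t then \<phi> q else inv \<phi> q)"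
    using bidirected_no_loops(2)[OF loopfree] par(1,2) by (simp_all add: label_from_def)
  then have "lab ?x p \<otimes> lab ?y q = \<one>"
    using W(3) par(1,2) unfolding W_eq by (simp add: gain_def label_closed)
  then have "lab ?x p = lab ?x q"
    using par(1,2) lab_reverse[OF pq(2)] by (simp add: lab_closed inv_solve_right' inv_equality)
  moreover have "inj_on (lab ?x) (cls ?x ?y)"
    using lab_bij class_verts[OF pq(1)] by (auto simp: bij_betw_def)
  ultimately show False using pq par(3) by (auto dest: inj_onD)
qed

lemma indep_arcs_iff:
  assumes "X \<subseteq> arcs G"
  shows "X \<in> indep M \<longleftrightarrow> (\<forall>C\<in>lift_circuits \<Gamma> G \<phi>. \<not> C \<subseteq> X)"
proof -
  have "X \<in> indep M \<longleftrightarrow> X \<in> indep (delete M e0)"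
    using assms e0 by (auto simp: delete_def)
  also have "\<dots> \<longleftrightarrow> (\<forall>C\<in>lift_circuits \<Gamma> G \<phi>. \<not> C \<subseteq> X)"
    using assms by (simp add: delete_e0 lift_matroid_def matroid_of_circuits_def)
  finally show ?thesis .
qed

text \<open>The balance conditions are dropped for all but the first kind: in the small sets
  examined below, the other kinds are excluded by their shape.\<close>

lemma lift_circuit_cases:
  assumes "C \<in> lift_circuits \<Gamma> G \<phi>"
  obtains "C \<in> balanced_cycles \<Gamma> G \<phi>"
  | A B where "A \<in> cycles G" "B \<in> cycles G" "C = A \<union> B"
      "verts_of G A \<inter> verts_of G B = {} \<or> card (verts_of G A \<inter> verts_of G B) = 1"
  | "C \<in> thetas G"
  using assms cycles_balanced_or_unbalanced unfolding lift_circuits_def by blast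

lemma verts_of_class:
  assumes "a \<in> cls x y"
  shows "{x, y} \<subseteq> verts_of G (insert a A)"
  using assms by (auto simp: parallel_class_def verts_of_def ends_def doubleton_eq_iff)

text \<open>An edge without loops already contributes two vertices. This excludes unions of two
  cycles sharing at most one vertex when both cycles are forced to be the same set.\<close>

lemma large_verts_of:
  assumes "a \<in> C" "a \<in> arcs G" "C \<subseteq> arcs G"
  shows "verts_of G C \<noteq> {}" "card (verts_of G C) \<noteq> 1"
proof -
  obtain x y where xy: "x \<noteq> y" "a \<in> cls x y" using arc_class[OF assms(2)] by metis
  have sub: "{x, y} \<subseteq> verts_of G C"
    using verts_of_class[OF xy(2), of C] assms(1) by (simp add: insert_absorb)
  then show "verts_of G C \<noteq> {}" by auto
  show "card (verts_of G C) \<noteq> 1" using sub xy(1) by (auto simp: card_1_singleton_iff)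
qed

lemma parallel_pair_indep:
  assumes "a \<in> arcs G" "b \<in> arcs G" "a \<noteq> b" "ends G a = ends G b"
  shows "{a, b} \<in> indep M"
proof -
  have "\<not> C \<subseteq> {a, b}" if "C \<in> lift_circuits \<Gamma> G \<phi>" for C
  proof
    assume C: "C \<subseteq> {a, b}"
    from that show False
    proof (cases rule: lift_circuit_cases)
      case 1
      then show False
        using C cycle_within_pair(1)[OF loopfree _ C] digon_not_balanced[OF assms(3,4)]
          cycles_balanced_or_unbalanced by auto
    next
      case (2 A B)
      then have "A = {a, b}" "B = {a, b}"
        using C cycle_within_pair(1)[OF loopfree, of _ a b] by auto
      then show False using 2(4) large_verts_of[of a "{a, b}"] assms by auto
    next
      case 3
      \<comment> \<open>Listing b twice turns the pair into a triple, whose entries a theta would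
        force to be distinct.\<close>
      then show False using theta_three_parallel(3)[of C G a b b] C loopfree by auto
    qed
  qed
  then show ?thesis using indep_arcs_iff assms by auto
qed

lemma parallel_pair_cycle:
  assumes "a \<in> arcs G" "b \<in> arcs G" "a \<noteq> b" "ends G a = ends G b"
  shows "{a, b} \<in> cycles G"
proof -
  obtain x y where "x \<noteq> y" "a \<in> cls x y" using arc_class[OF assms(1)] by metis
  then have "simple_closed_walk G [(a, tail G a = x), (b, tail G b = y)]"
    using assms by (intro digon_closed_walk[OF wf]) (auto simp: parallel_class_def)
  then show ?thesis unfolding cycles_def edges_of_def by force
qed

text \<open>Contracting a loop deletes it, which would make the lift matroid equal to the cycle
  matroid. Two parallel edges tell them apart: independent in the former, a cycle in the
  latter.\<close>

lemma e0_not_loop: "{e0} \<in> indep M"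
proof (rule ccontr)
  assume "{e0} \<notin> indep M"
  then have eq: "delete M e0 = cycle_matroid G" using contract_e0 by (simp add: contract_def)
  obtain x y z where xy: "x \<in> verts G" "y \<in> verts G" "distinct [x, y, z]"
    using three_vertices by metis
  then have "card (cls x y) \<ge> 2" using card_class card_ge by simp
  then obtain a b where ab: "a \<in> cls x y" "b \<in> cls x y" "a \<noteq> b"
    by (meson card_2_iff' obtain_subset_with_card_n subsetD)
  then have ab': "a \<in> arcs G" "b \<in> arcs G" "ends G a = ends G b"
    by (auto simp: parallel_class_def)
  then have "{a, b} \<in> indep (delete M e0)"
    using parallel_pair_indep ab(3) e0 by (auto simp: delete_def)
  moreover have "{a, b} \<notin> indep (cycle_matroid G)"
    using parallel_pair_cycle ab' ab(3) by (auto simp: cycle_matroid_def matroid_of_circuits_def)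
  ultimately show False using eq by simp
qed

lemma indep_insert_e0_iff:
  assumes "X \<subseteq> arcs G"
  shows "insert e0 X \<in> indep M \<longleftrightarrow> (\<forall>C\<in>cycles G. \<not> C \<subseteq> X)"
proof -
  have "insert e0 X \<in> indep M \<longleftrightarrow> X \<in> indep (contract M e0)"
    using assms e0 e0_not_loop by (auto simp: contract_def)
  also have "\<dots> \<longleftrightarrow> (\<forall>C\<in>cycles G. \<not> C \<subseteq> X)"
    using assms by (simp add: contract_e0 cycle_matroid_def matroid_of_circuits_def)
  finally show ?thesis .
qed

text \<open>In the cycle matroid, the contraction by \<open>e0\<close>, a pair of edges is dependent
  only as a digon. Once \<open>e0\<close> is located, the matroid thus sees which edges are
  parallel.\<close>

lemma indep_e0_pair_iff:
  assumes "a \<in> arcs G" "b \<in> arcs G" "a \<noteq> b"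
  shows "{e0, a, b} \<in> indep M \<longleftrightarrow> ends G a \<noteq> ends G b"
proof -
  have "{e0, a, b} \<in> indep M \<longleftrightarrow> (\<forall>C\<in>cycles G. \<not> C \<subseteq> {a, b})"
    using assms by (intro indep_insert_e0_iff) auto
  also have "\<dots> \<longleftrightarrow> ends G a \<noteq> ends G b"
    using cycle_within_pair(3)[OF loopfree] parallel_pair_cycle assms by blast
  finally show ?thesis .
qed

lemma indep_subset: "J \<in> indep M \<Longrightarrow> I \<subseteq> J \<Longrightarrow> I \<in> indep M"
  using matroid unfolding is_matroid_def by blast

lemma indep_augment:
  "I \<in> indep M \<Longrightarrow> J \<in> indep M \<Longrightarrow> card I < card J \<Longrightarrow> \<exists>x\<in>J - I. insert x I \<in> indep M"
  using matroid unfolding is_matroid_def by blast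

section \<open>Balanced triangles as dependent triples\<close>

lemma balanced_rotate:
  assumes "triangle G x y z a b c" "lab x a \<otimes> lab y b \<otimes> lab z c = \<one>"
  shows "lab y b \<otimes> lab z c \<otimes> lab x a = \<one>"
proof -
  have c: "lab x a \<in> carrier \<Gamma>" "lab y b \<in> carrier \<Gamma>" "lab z c \<in> carrier \<Gamma>"
    using assms(1) by (auto simp: triangle_def lab_closed class_verts)
  then have "lab x a \<otimes> (lab y b \<otimes> lab z c) = \<one>" using assms(2) by (simp add: m_assoc)
  \<comment> \<open>The first factor is inverse to the product of the other two, and a one-sided
    inverse in a group is two-sided.\<close>
  then show ?thesis using c by (metis inv_comm m_closed)
qed

text \<open>Walking backward inverts every label and reverses their order, hence inverts the whole
  product.\<close>

lemma balanced_reverse: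
  assumes "triangle G x y z a b c" "lab x a \<otimes> lab y b \<otimes> lab z c = \<one>"
  shows "lab x c \<otimes> lab z b \<otimes> lab y a = \<one>"
proof -
  have cl: "a \<in> cls x y" "b \<in> cls y z" "c \<in> cls z x"
    using assms(1) by (auto simp: triangle_def)
  then have c: "lab x a \<in> carrier \<Gamma>" "lab y b \<in> carrier \<Gamma>" "lab z c \<in> carrier \<Gamma>"
    by (auto simp: lab_closed class_verts)
  have "lab x c \<otimes> lab z b \<otimes> lab y a = inv (lab z c) \<otimes> inv (lab y b) \<otimes> inv (lab x a)"
    using cl by (simp add: lab_reverse)
  also have "\<dots> = inv (lab x a \<otimes> lab y b \<otimes> lab z c)"
    using c by (simp add: inv_mult_group m_assoc)
  finally show ?thesis using assms(2) by simp
qed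

lemma gain_triangle:
  assumes "triangle G x y z a b c"
  shows "gain \<Gamma> \<phi> [(a, tail G a = x), (b, tail G b = y), (c, tail G c = z)]
    = lab x a \<otimes> lab y b \<otimes> lab z c"
proof -
  have "a \<in> arcs G" "b \<in> arcs G" "c \<in> arcs G"
    using assms by (auto simp: triangle_def class_verts)
  then show ?thesis
    using label_closed by (simp add: gain_def label_from_def m_assoc)
qed

text \<open>Balance only promises some walk of gain one. Any walk around the triangle differs from
  the given one by rotation and reversal, and both preserve gain one.\<close>

lemma balanced_triangle_iff:
  assumes t: "triangle G x y z a b c"
  shows "{a, b, c} \<in> balanced_cycles \<Gamma> G \<phi> \<longleftrightarrow> lab x a \<otimes> lab y b \<otimes> lab z c = \<one>"
proof
  assume "lab x a \<otimes> lab y b \<otimes> lab z c = \<one>"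
  then show "{a, b, c} \<in> balanced_cycles \<Gamma> G \<phi>"
    using triangle_closed_walk[OF wf t] gain_triangle[OF t]
    unfolding balanced_cycles_def edges_of_def by force
next
  assume "{a, b, c} \<in> balanced_cycles \<Gamma> G \<phi>"
  then obtain W where W: "simple_closed_walk G W" "{a, b, c} = edges_of W" "gain \<Gamma> \<phi> W = \<one>"
    by (auto simp: balanced_cycles_def)
  have "a \<noteq> b" "a \<noteq> c" "b \<noteq> c" using triangle_ends_distinct[OF t] by auto
  then have "length W = 3" using card_edges_of[OF W(1)] W(2)[symmetric] by simp
  then obtain u v w p q r where t': "triangle G u v w p q r"
    and W': "W = [(p, tail G p = u), (q, tail G q = v), (r, tail G r = w)]" "edges_of W = {p, q, r}"
    using card_3_cycle_triangle[OF loopfree W(1)] by metis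
  have "{a, b, c} = {p, q, r}" using W(2) W'(2) by simp
  note rel = triangle_relabel[OF t t' this]
  have 1: "lab u p \<otimes> lab v q \<otimes> lab w r = \<one>"
    using W(3) gain_triangle[OF t'] unfolding W'(1) by simp
  \<comment> \<open>Together with \<open>1\<close>, these facts give gain one for all six orders
    listed in \<open>rel\<close>.\<close>
  note 2 = balanced_rotate[OF t' 1]
  note 3 = balanced_rotate[OF triangle_rotate[OF t'] 2]
  note r1 = balanced_reverse[OF t' 1]
  note r2 = balanced_rotate[OF triangle_reverse[OF t'] r1]
  note r3 = balanced_rotate[OF triangle_rotate[OF triangle_reverse[OF t']] r2]
  show "lab x a \<otimes> lab y b \<otimes> lab z c = \<one>"
    using rel 1 2 3 r1 r2 r3 by (elim insertE emptyE) simp_all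
qed

text \<open>Every cycle inside the triple uses all three edges, so two cycles in it coincide and
  share more than one vertex; a theta would need parallel edges. Only a balanced triangle remains as
  a circuit.\<close>

lemma nonparallel_triple_indep_iff:
  assumes "{a, b, c} \<subseteq> arcs G"
    and "ends G a \<noteq> ends G b" "ends G a \<noteq> ends G c" "ends G b \<noteq> ends G c"
  shows "{a, b, c} \<in> indep M \<longleftrightarrow> {a, b, c} \<notin> balanced_cycles \<Gamma> G \<phi>"
proof -
  have "C \<in> balanced_cycles \<Gamma> G \<phi> \<and> C = {a, b, c}"
    if "C \<in> lift_circuits \<Gamma> G \<phi>" and C: "C \<subseteq> {a, b, c}" for C
  proof -
    note all = cycle_within_nonparallel_triple[OF loopfree _ _ assms(2-4)]
    from that(1) show ?thesis
    proof (cases rule: lift_circuit_cases)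
      case 1
      then show ?thesis using all[OF _ C] cycles_balanced_or_unbalanced by auto
    next
      case (2 A B)
      then have "A = {a, b, c}" "B = {a, b, c}" using all C by auto
      then show ?thesis using 2(4) large_verts_of[of a "{a, b, c}"] assms(1) by auto
    next
      case 3
      then show ?thesis using theta_three_parallel(4)[OF _ C loopfree] assms(2) by auto
    qed
  qed
  moreover have "balanced_cycles \<Gamma> G \<phi> \<subseteq> lift_circuits \<Gamma> G \<phi>"
    unfolding lift_circuits_def by blast
  ultimately show ?thesis
    unfolding indep_arcs_iff[OF assms(1)] by blast
qed

lemma triangle_indep_iff:
  assumes "triangle G x y z a b c"
  shows "{a, b, c} \<in> indep M \<longleftrightarrow> lab x a \<otimes> lab y b \<otimes> lab z c \<noteq> \<one>"
proof -
  have "{a, b, c} \<subseteq> arcs G" using assms by (auto simp: triangle_def class_verts)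
  then show ?thesis
    using nonparallel_triple_indep_iff[OF _ triangle_ends_distinct[OF assms]]
      balanced_triangle_iff[OF assms] by simp
qed

text \<open>The balanced walk may list the edges in another order; rotation and reversal restore the
  order a, b, c, on which the matching of parallel classes in \<open>groups_iso\<close>
  relies.\<close>

lemma dependent_triple_triangle:
  assumes "{a, b, c} \<subseteq> arcs G"
    and "ends G a \<noteq> ends G b" "ends G a \<noteq> ends G c" "ends G b \<noteq> ends G c"
    and "{a, b, c} \<notin> indep M"
  obtains x y z where "triangle G x y z a b c"
proof -
  have "{a, b, c} \<in> balanced_cycles \<Gamma> G \<phi>"
    using nonparallel_triple_indep_iff assms by blast
  then obtain W where W: "simple_closed_walk G W" "{a, b, c} = edges_of W"
    by (auto simp: balanced_cycles_def)
  have d: "a \<noteq> b" "a \<noteq> c" "b \<noteq> c" using assms by auto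
  then have "length W = 3" using card_edges_of[OF W(1)] W(2)[symmetric] by simp
  then obtain u v w p q r where t: "triangle G u v w p q r" and "{p, q, r} = {a, b, c}"
    using card_3_cycle_triangle[OF loopfree W(1)] W(2) by metis
  then have "a \<in> {p, q, r}" "b \<in> {p, q, r}" "c \<in> {p, q, r}" by blast+
  with d consider "a = p" "b = q" "c = r" | "a = q" "b = r" "c = p" | "a = r" "b = p" "c = q"
    | "a = r" "b = q" "c = p" | "a = q" "b = p" "c = r" | "a = p" "b = r" "c = q"
    by (elim insertE emptyE) simp_all
  then show ?thesis
    by cases (use t that in \<open>blast intro: triangle_rotate triangle_reverse\<close>)+
qed

section \<open>Long lines\<close>

text \<open>Augmenting \<open>{a, b}\<close> from the independent set \<open>{e0, c, a}\<close> can
  only add c, because \<open>e0\<close> is dependent with the parallel pair.\<close>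

lemma two_parallel_triple_indep:
  assumes "a \<in> arcs G" "b \<in> arcs G" "c \<in> arcs G" "a \<noteq> b" "ends G a = ends G b"
    "ends G c \<noteq> ends G a"
  shows "{a, b, c} \<in> indep M"
proof -
  have "{e0, c, a} \<in> indep M" "{a, b} \<in> indep M"
    using assms indep_e0_pair_iff[of c a] parallel_pair_indep by auto
  moreover have "card {a, b} < card {e0, c, a}" using assms e0 by (auto simp: card_insert_if)
  ultimately obtain x where "x \<in> {e0, c, a} - {a, b}" "insert x {a, b} \<in> indep M"
    using indep_augment by blast
  moreover have "insert e0 {a, b} \<notin> indep M" using indep_e0_pair_iff assms by simp
  ultimately show ?thesis by (auto simp: insert_commute)
qed

text \<open>At least four points of rank at most two, expressed by independence alone so that
  isomorphisms preserve it. Three points would not do, since balanced triangles are dependent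
  triples as well.\<close>

definition long_line :: "'e set \<Rightarrow> bool" where
  "long_line X \<longleftrightarrow> X \<subseteq> ground M \<and> card X \<ge> 4 \<and> (\<forall>Y\<subseteq>X. card Y = 3 \<longrightarrow> Y \<notin> indep M)"

text \<open>If a and b were not parallel, every further point would close a triangle with them and
  so lie in one fixed class. Two such points are parallel and hence independent together with
  a.\<close>

lemma long_line_parallel:
  assumes "long_line X" "a \<in> X - {e0}" "b \<in> X - {e0}"
  shows "ends G a = ends G b"
proof (rule ccontr)
  assume ab: "ends G a \<noteq> ends G b"
  have X: "X \<subseteq> insert e0 (arcs G)" "card X \<ge> 4"
    and dep: "\<And>p q r. {p, q, r} \<subseteq> X \<Longrightarrow> distinct [p, q, r] \<Longrightarrow> {p, q, r} \<notin> indep M"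
    using assms(1) ground by (auto simp: long_line_def)
  have arcs: "a \<in> arcs G" "b \<in> arcs G" and "a \<noteq> b" using assms X ab by auto
  \<comment> \<open>Having four points on the line guarantees two beyond a and b.\<close>
  have "card (X - {a, b}) \<ge> 2"
    using X assms \<open>a \<noteq> b\<close> by (subst card_Diff_subset) auto
  then obtain c d where cd: "c \<in> X - {a, b}" "d \<in> X - {a, b}" "c \<noteq> d"
    by (meson card_2_iff' obtain_subset_with_card_n subsetD)
  have "e0 \<notin> X"
    using dep[of e0 a b] indep_e0_pair_iff[OF arcs \<open>a \<noteq> b\<close>] assms ab \<open>a \<noteq> b\<close> by auto
  then have arcs': "c \<in> arcs G" "d \<in> arcs G" using cd X by auto
  \<comment> \<open>A point parallel to one of a and b would form an independent triple with
    both.\<close>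
  have nonpar: "ends G e \<noteq> ends G a \<and> ends G e \<noteq> ends G b" if "e \<in> X - {a, b}" for e
    using two_parallel_triple_indep[of e a b] two_parallel_triple_indep[of e b a] that X
      \<open>e0 \<notin> X\<close> arcs ab dep[of e a b] \<open>a \<noteq> b\<close> assms(2,3)
    by (auto simp: insert_commute)
  have tri: "\<exists>x y z. triangle G x y z a b e" if "e \<in> X - {a, b}" for e
  proof -
    have "{a, b, e} \<subseteq> arcs G" "{a, b, e} \<notin> indep M"
      using that arcs X \<open>e0 \<notin> X\<close> dep[of a b e] \<open>a \<noteq> b\<close> assms(2,3) by auto
    then show ?thesis
      using dependent_triple_triangle[of a b e] ab nonpar[OF that] by metis
  qed
  obtain x y z x' y' z' where t: "triangle G x y z a b c" "triangle G x' y' z' a b d"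
    using tri cd by blast
  \<comment> \<open>The ends of the third side are the two ends that a and b do not share.\<close>
  have "ends G c = ends G d"
  proof -
    have "{x, y} = {x', y'}" "{y, z} = {y', z'}" "distinct [x, y, z]" "distinct [x', y', z']"
      and "ends G c = {z, x}" "ends G d = {z', x'}"
      using t by (auto simp: triangle_def parallel_class_def)
    then show ?thesis by (auto simp: doubleton_eq_iff)
  qed
  then have "{c, d, a} \<in> indep M"
    using two_parallel_triple_indep[of c d a] arcs arcs' cd(3) nonpar[OF cd(1)] by auto
  moreover have "{c, d, a} \<notin> indep M"
    using cd assms(2) by (intro dep) auto
  ultimately show False by simp
qed

text \<open>A triple containing \<open>e0\<close> holds a parallel pair. An independent triple
  inside the class would extend \<open>{e0}\<close> twice by augmentation, again making
  \<open>e0\<close> independent with a parallel pair.\<close>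

lemma class_long_line:
  assumes "x \<in> verts G" "y \<in> verts G" "x \<noteq> y" "card (carrier \<Gamma>) \<ge> 3"
  shows "long_line (insert e0 (cls x y))"
proof -
  have fin: "finite (cls x y)" "e0 \<notin> cls x y" "cls x y \<subseteq> arcs G"
    using finite_arcs e0 by (auto simp: parallel_class_def)
  have par: "{e0, a, b} \<notin> indep M" if "a \<in> cls x y" "b \<in> cls x y" "a \<noteq> b" for a b
    using that indep_e0_pair_iff[of a b] by (auto simp: parallel_class_def)
  have "Y \<notin> indep M" if Y: "Y \<subseteq> insert e0 (cls x y)" "card Y = 3" for Y
  proof
    assume ind: "Y \<in> indep M"
    show False
    proof (cases "e0 \<in> Y")
      case True
      have "card (Y - {e0}) = 2" using Y True by simp
      then obtain a b where "Y - {e0} = {a, b}" "a \<noteq> b" by (auto simp: card_2_iff)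
      then have "Y = {e0, a, b}" "a \<in> cls x y" "b \<in> cls x y" using True Y by auto
      then show False using par ind \<open>a \<noteq> b\<close> by auto
    next
      case False
      then have Yc: "Y \<subseteq> cls x y" using Y by auto
      obtain J where J: "J \<subseteq> Y" "card J = 2"
        using Y(2) obtain_subset_with_card_n[of 2 Y] by auto
      have "J \<in> indep M" using J ind indep_subset by blast
      then obtain a where a: "a \<in> J" "{e0, a} \<in> indep M"
        using indep_augment[OF e0_not_loop, of J] J Yc fin(2) by (auto simp: insert_commute)
      have "a \<in> cls x y" "a \<noteq> e0" using a J Yc fin by auto
      then have "card {e0, a} < card Y" using Y(2) by simp
      then obtain b where "b \<in> Y - {e0, a}" "insert b {e0, a} \<in> indep M"
        using indep_augment[OF a(2) ind] by blast
      then show False using par[of a b] \<open>a \<in> cls x y\<close> Yc by (auto simp: insert_commute)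
    qed
  qed
  \<comment> \<open>Group order at least three is what provides the fourth point.\<close>
  moreover have "card (insert e0 (cls x y)) \<ge> 4"
    using fin card_class[OF assms(1-3)] assms(4) by simp
  ultimately show ?thesis
    using ground fin(3) by (auto simp: long_line_def)
qed

end

section \<open>Isomorphisms\<close>

locale LG_plus_iso =
  L: LG_plus \<Gamma> k G \<phi> e0 M + L': LG_plus \<Gamma>' k G' \<phi>' e0' M'
  for k :: nat
    and \<Gamma> :: "('g, 'm) monoid_scheme" and \<Gamma>' :: "('h, 'n) monoid_scheme"
    and G :: "('v, 'e) pre_digraph" and G' :: "('w, 'f) pre_digraph"
    and \<phi> :: "'e \<Rightarrow> 'g" and \<phi>' :: "'f \<Rightarrow> 'h"
    and e0 :: 'e and e0' :: 'f
    and M :: "'e matroid" and M' :: "'f matroid" +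
  fixes f :: "'e \<Rightarrow> 'f"
  assumes f_bij: "bij_betw f (ground M) (ground M')"
    and f_indep: "X \<subseteq> ground M \<Longrightarrow> X \<in> indep M \<longleftrightarrow> f ` X \<in> indep M'"
begin

text \<open>The ground sets have equal size, and k is common to both sides, so the number of vertex
  pairs cancels.\<close>

lemma card_carrier: "card (carrier \<Gamma>) = card (carrier \<Gamma>')"
proof -
  have "card (arcs G) = card (arcs G')"
    using bij_betw_same_card[OF f_bij] L.finite_arcs L'.finite_arcs L.e0 L'.e0
    by (simp add: L.ground L'.ground)
  moreover have "k choose 2 > 0" using L.k_ge by simp
  ultimately show ?thesis by (simp add: L.card_arcs L'.card_arcs)
qed

lemma image_long_line:
  assumes "L.long_line X"
  shows "L'.long_line (f ` X)"
proof -
  have X: "X \<subseteq> ground M" "card X \<ge> 4" and dep: "\<And>Y. Y \<subseteq> X \<Longrightarrow> card Y = 3 \<Longrightarrow> Y \<notin> indep M"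
    using assms by (auto simp: L.long_line_def)
  have inj: "inj_on f X"
    using f_bij X(1) by (auto simp: bij_betw_def intro: inj_on_subset)
  have "Y \<notin> indep M'" if Y: "Y \<subseteq> f ` X" "card Y = 3" for Y
  proof -
    obtain Z where Z: "Z \<subseteq> X" "Y = f ` Z" using Y(1) by (rule subset_imageE)
    then have "card Z = 3" using Y(2) inj by (metis card_image inj_on_subset)
    then have "Z \<notin> indep M" using dep Z by blast
    then show ?thesis using f_indep Z X(1) by blast
  qed
  moreover have "f ` X \<subseteq> ground M'" using f_bij X(1) by (auto simp: bij_betw_def)
  ultimately show ?thesis
    using X(2) card_image[OF inj] by (simp add: L'.long_line_def)
qed

text \<open>Two classes at u give two long lines through \<open>e0\<close>. If \<open>f e0\<close>
  were an edge, all points of both images other than \<open>e0'\<close> would be parallel to it.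
  With n the group order, 2n + 1 points would then fit into a set of at most n + 1.\<close>

lemma f_e0:
  assumes n: "card (carrier \<Gamma>) \<ge> 3"
  shows "f e0 = e0'"
proof (rule ccontr)
  assume ne: "f e0 \<noteq> e0'"
  obtain u v w where V: "u \<in> verts G" "v \<in> verts G" "w \<in> verts G" and d: "distinct [u, v, w]"
    using L.three_vertices .
  have ll: "L'.long_line (f ` insert e0 (L.cls u v))" "L'.long_line (f ` insert e0 (L.cls u w))"
    using V d n by (intro image_long_line L.class_long_line; simp)+
  let ?S = "insert e0 (L.cls u v \<union> L.cls u w)"
  have S: "?S \<subseteq> ground M" by (auto simp: L.ground parallel_class_def)
  have fS: "f ` ?S \<subseteq> ground M'" using f_bij S by (auto simp: bij_betw_def)
  have "f e0 \<in> arcs G'" using fS ne by (auto simp: L'.ground)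
  then obtain x y where xy: "x \<in> verts G'" "y \<in> verts G'" "x \<noteq> y" "f e0 \<in> L'.cls x y"
    using L'.arc_class by blast
  have "f ` ?S \<subseteq> insert e0' (L'.cls x y)"
  proof
    fix b assume b: "b \<in> f ` ?S"
    show "b \<in> insert e0' (L'.cls x y)"
    proof (cases "b = e0'")
      case False
      from b consider "b \<in> f ` insert e0 (L.cls u v)" | "b \<in> f ` insert e0 (L.cls u w)"
        by blast
      then have "ends G' b = ends G' (f e0)"
      proof cases
        case 1
        then show ?thesis using False ne by (intro L'.long_line_parallel[OF ll(1)]) auto
      next
        case 2
        then show ?thesis using False ne by (intro L'.long_line_parallel[OF ll(2)]) auto
      qed
      moreover have "b \<in> arcs G'" using b fS False by (auto simp: L'.ground)
      ultimately show ?thesis using xy(4) by (auto simp: parallel_class_def)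
    qed simp
  qed
  moreover have fin: "finite (L'.cls x y)"
    using L'.finite_arcs by (simp add: parallel_class_def)
  ultimately have "card (f ` ?S) \<le> card (insert e0' (L'.cls x y))"
    by (intro card_mono) simp_all
  also have "\<dots> \<le> card (carrier \<Gamma>') + 1"
    using L'.card_class[OF xy(1-3)] fin by (simp add: card_insert_if)
  finally have "card (f ` ?S) \<le> card (carrier \<Gamma>) + 1" by (simp add: card_carrier)
  moreover have "card (f ` ?S) = card ?S"
    using inj_on_subset[OF bij_betw_imp_inj_on[OF f_bij] S] by (rule card_image)
  moreover have "card ?S = 2 * card (carrier \<Gamma>) + 1"
  proof -
    have "L.cls u v \<inter> L.cls u w = {}"
      using d by (auto simp: parallel_class_def doubleton_eq_iff)
    moreover have "finite (L.cls u v)" "finite (L.cls u w)" "e0 \<notin> L.cls u v \<union> L.cls u w"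
      using L.finite_arcs L.e0 by (auto simp: parallel_class_def)
    ultimately show ?thesis
      using L.card_class V d by (simp add: card_Un_disjoint)
  qed
  ultimately show False using n by simp
qed

section \<open>Transport of parallel classes and balanced triangles\<close>

context
  assumes fe0: "f e0 = e0'"
begin

lemma f_arcs: "f ` arcs G = arcs G'" and f_inj: "inj_on f (arcs G)"
proof -
  have inj: "inj_on f (insert e0 (arcs G))" and im: "f ` insert e0 (arcs G) = insert e0' (arcs G')"
    using f_bij by (simp_all add: bij_betw_def L.ground L'.ground)
  show "inj_on f (arcs G)" using inj by (rule inj_on_subset) auto
  have "e0' \<notin> f ` arcs G" using inj L.e0 fe0 by auto
  then show "f ` arcs G = arcs G'"
    using im fe0 L'.e0 by (simp add: insert_ident)
qed

text \<open>Parallelism is dependence together with \<open>e0\<close>, and \<open>f\<close>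
  preserves both dependence and this point.\<close>

lemma f_parallel:
  assumes "a \<in> arcs G" "b \<in> arcs G"
  shows "ends G' (f a) = ends G' (f b) \<longleftrightarrow> ends G a = ends G b"
proof (cases "a = b")
  case False
  have "f a \<noteq> f b" using False f_inj assms by (auto dest: inj_onD)
  then have "{e0', f a, f b} \<in> indep M' \<longleftrightarrow> ends G' (f a) \<noteq> ends G' (f b)"
    using assms f_arcs by (intro L'.indep_e0_pair_iff) auto
  moreover have "{e0, a, b} \<in> indep M \<longleftrightarrow> {e0', f a, f b} \<in> indep M'"
    using f_indep[of "{e0, a, b}"] assms fe0 by (simp add: L.ground)
  ultimately show ?thesis using L.indep_e0_pair_iff[OF assms False] by blast
qed simp

lemma f_class:
  assumes "a \<in> L.cls x y" "f a \<in> L'.cls p q"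
  shows "bij_betw f (L.cls x y) (L'.cls p q)"
proof -
  have xy: "L.cls x y = {e \<in> arcs G. ends G e = ends G a}"
    and pq: "L'.cls p q = {e \<in> arcs G'. ends G' e = ends G' (f a)}"
    using assms by (auto simp: parallel_class_def)
  have a: "a \<in> arcs G" using assms by (simp add: parallel_class_def)
  have "inj_on f (L.cls x y)"
    using f_inj by (rule inj_on_subset) (auto simp: parallel_class_def)
  moreover have "f ` L.cls x y = L'.cls p q"
    unfolding xy pq using f_parallel[OF _ a] by (auto simp: f_arcs[symmetric])
  ultimately show ?thesis by (simp add: bij_betw_def)
qed

lemma groups_iso: "\<Gamma> \<cong> \<Gamma>'"
proof -
  obtain u v w where V: "u \<in> verts G" "v \<in> verts G" "w \<in> verts G" and d: "distinct [u, v, w]"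
    using L.three_vertices .
  have bij: "bij_betw (L.lab u) (L.cls u v) (carrier \<Gamma>)"
    "bij_betw (L.lab v) (L.cls v w) (carrier \<Gamma>)" "bij_betw (L.lab w) (L.cls w u) (carrier \<Gamma>)"
    using V d by (auto intro!: L.lab_bij)
  have ex1: "\<exists>e\<in>A. h e = \<one>\<^bsub>\<Gamma>\<^esub>" if "bij_betw h A (carrier \<Gamma>)" for h and A :: "'e set"
    using bij_betw_imp_surj_on[OF that] L.one_closed by (metis imageE)
  \<comment> \<open>A base triangle with all labels one is balanced; its image selects the three
    classes of \<open>G'\<close> to be compared with those of \<open>G\<close>.\<close>
  obtain a b c where abc: "a \<in> L.cls u v" "b \<in> L.cls v w" "c \<in> L.cls w u"
    and lab1: "L.lab u a = \<one>\<^bsub>\<Gamma>\<^esub>" "L.lab v b = \<one>\<^bsub>\<Gamma>\<^esub>" "L.lab w c = \<one>\<^bsub>\<Gamma>\<^esub>"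
    using ex1[OF bij(1)] ex1[OF bij(2)] ex1[OF bij(3)] by blast
  have image: "{f a', f b', f c'} \<in> indep M' \<longleftrightarrow> L.lab u a' \<otimes>\<^bsub>\<Gamma>\<^esub> L.lab v b' \<otimes>\<^bsub>\<Gamma>\<^esub> L.lab w c' \<noteq> \<one>\<^bsub>\<Gamma>\<^esub>"
    if "a' \<in> L.cls u v" "b' \<in> L.cls v w" "c' \<in> L.cls w u" for a' b' c'
  proof -
    have t: "triangle G u v w a' b' c'" using that d by (simp add: triangle_def)
    have "{a', b', c'} \<subseteq> ground M" using that by (auto simp: L.ground parallel_class_def)
    from f_indep[OF this] show ?thesis using L.triangle_indep_iff[OF t] by simp
  qed
  have t: "triangle G u v w a b c" using abc d by (simp add: triangle_def)
  have arcs: "a \<in> arcs G" "b \<in> arcs G" "c \<in> arcs G" using abc by (auto simp: parallel_class_def)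
  have "{f a, f b, f c} \<subseteq> arcs G'" using arcs f_arcs by auto
  moreover have "{f a, f b, f c} \<notin> indep M'" using image[OF abc] lab1 by simp
  moreover have "ends G' (f a) \<noteq> ends G' (f b)" "ends G' (f a) \<noteq> ends G' (f c)"
    "ends G' (f b) \<noteq> ends G' (f c)"
    using f_parallel arcs triangle_ends_distinct[OF t] by auto
  \<comment> \<open>By \<open>f_class\<close>, the vertices found for the base triangle serve for
    all edges of its three classes.\<close>
  ultimately obtain p q r where t': "triangle G' p q r (f a) (f b) (f c)"
    using L'.dependent_triple_triangle by metis
  then have fabc: "f a \<in> L'.cls p q" "f b \<in> L'.cls q r" "f c \<in> L'.cls r p"
    by (auto simp: triangle_def)
  note f_cls = f_class[OF abc(1) fabc(1)] f_class[OF abc(2) fabc(2)] f_class[OF abc(3) fabc(3)]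
  have bij': "bij_betw (L'.lab p) (L'.cls p q) (carrier \<Gamma>')"
    "bij_betw (L'.lab q) (L'.cls q r) (carrier \<Gamma>')" "bij_betw (L'.lab r) (L'.cls r p) (carrier \<Gamma>')"
    using L'.class_verts[OF fabc(1)] L'.class_verts[OF fabc(2)] L'.class_verts[OF fabc(3)]
    by (auto intro!: L'.lab_bij)
  \<comment> \<open>These send a group element to the edge of the class that carries it as label;
    following them by \<open>f\<close> and the labels in \<open>G'\<close> yields the three
    bijections of an isotopy.\<close>
  let ?A = "inv_into (L.cls u v) (L.lab u)" and ?B = "inv_into (L.cls v w) (L.lab v)"
    and ?C = "inv_into (L.cls w u) (L.lab w)"
  note inv_bij = bij[THEN bij_betw_inv_into]
  note transfer = bij_betw_trans[OF bij_betw_trans]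
  show ?thesis
  proof (rule isotopic_groups_iso)
    show "Group.group \<Gamma>" "Group.group \<Gamma>'" by unfold_locales
    show "bij_betw (L'.lab p \<circ> (f \<circ> ?A)) (carrier \<Gamma>) (carrier \<Gamma>')"
      "bij_betw (L'.lab q \<circ> (f \<circ> ?B)) (carrier \<Gamma>) (carrier \<Gamma>')"
      "bij_betw (L'.lab r \<circ> (f \<circ> ?C)) (carrier \<Gamma>) (carrier \<Gamma>')"
      using transfer[OF inv_bij(1) f_cls(1) bij'(1)] transfer[OF inv_bij(2) f_cls(2) bij'(2)]
        transfer[OF inv_bij(3) f_cls(3) bij'(3)] by simp_all
  next
    fix x y z
    assume xyz: "x \<in> carrier \<Gamma>" "y \<in> carrier \<Gamma>" "z \<in> carrier \<Gamma>"
      and one: "x \<otimes>\<^bsub>\<Gamma>\<^esub> y \<otimes>\<^bsub>\<Gamma>\<^esub> z = \<one>\<^bsub>\<Gamma>\<^esub>"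
    have cl: "?A x \<in> L.cls u v" "?B y \<in> L.cls v w" "?C z \<in> L.cls w u"
      using inv_bij xyz by (auto dest: bij_betwE)
    have "L.lab u (?A x) = x" "L.lab v (?B y) = y" "L.lab w (?C z) = z"
      using bij xyz by (simp_all add: bij_betw_inv_into_right)
    \<comment> \<open>The edges carrying x, y and z form a balanced triangle, so their images are
      dependent, which in the triangle on p, q and r means gain one.\<close>
    then have dep: "{f (?A x), f (?B y), f (?C z)} \<notin> indep M'"
      using image[OF cl] one by simp
    have "triangle G' p q r (f (?A x)) (f (?B y)) (f (?C z))"
      using t' cl f_cls by (auto simp: triangle_def dest: bij_betwE)
    then show "(L'.lab p \<circ> (f \<circ> ?A)) x \<otimes>\<^bsub>\<Gamma>'\<^esub> (L'.lab q \<circ> (f \<circ> ?B)) y \<otimes>\<^bsub>\<Gamma>'\<^esub> (L'.lab r \<circ> (f \<circ> ?C)) z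
      = \<one>\<^bsub>\<Gamma>'\<^esub>"
      using L'.triangle_indep_iff dep by simp
  qed
qed

end

end

theorem theorem4p2:
  fixes k :: nat
    and \<Gamma> :: "('g, 'm) monoid_scheme" and \<Gamma>' :: "('h, 'n) monoid_scheme"
    and G :: "('v, 'e) pre_digraph" and G' :: "('w, 'f) pre_digraph"
    and \<phi> :: "'e \<Rightarrow> 'g" and \<phi>' :: "'f \<Rightarrow> 'h"
    and e0 :: 'e and e0' :: 'f
    and M :: "'e matroid" and M' :: "'f matroid"
  assumes "k \<ge> 3"
    and "group \<Gamma>" and "finite (carrier \<Gamma>)" and "card (carrier \<Gamma>) \<ge> 2"
    and "group \<Gamma>'" and "finite (carrier \<Gamma>')" and "card (carrier \<Gamma>') \<ge> 2"
    and "is_LG_plus k \<Gamma> G \<phi> e0 M"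
    and "is_LG_plus k \<Gamma>' G' \<phi>' e0' M'"
    and "matroid_isomorphic M M'"
  shows "\<Gamma> \<cong> \<Gamma>'"
proof -
  obtain f where f: "bij_betw f (ground M) (ground M')"
    "\<forall>X\<subseteq>ground M. X \<in> indep M \<longleftrightarrow> f ` X \<in> indep M'"
    using assms(10) by (auto simp: matroid_isomorphic_def)
  interpret LG_plus_iso k \<Gamma> \<Gamma>' G G' \<phi> \<phi>' e0 e0' M M' f
    by (intro LG_plus_iso.intro LG_plus.intro LG_plus_axioms.intro LG_plus_iso_axioms.intro)
      (use assms f in blast)+
  show ?thesis
  proof (cases "card (carrier \<Gamma>) = 2")
    case True
    then show ?thesis using assms(2,5) card_carrier by (intro groups_of_order_2_iso) simp_all
  next
    case False
    then show ?thesis using f_e0 groups_iso assms(4) by simp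
  qed
qed

end
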